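(* Let $X$ and $Y$ be two Polish spaces endowed with their Borel $\sigma$-algebras $\mathcal{B}[X]$ and $\mathcal{B}[Y]$ and with atomless probability measures $\mu$ and $\nu$, respectively. Then there exists a set $E\in\mathcal{B}[X]\otimes^{\sigma}\mathcal{B}[Y]$ such that $E$ is not an element of $(\mathcal{B}[X]\otimes\mathcal{B}[Y])^{c}$.
   Context: All probability measures here are standard and countably additive. $\mathcal{B}[X]\otimes\mathcal{B}[Y]$ denotes the algebra (closed under finite, not countable, unions) of subsets of $X\times Y$ generated by the rectangles $A_1\times A_2$ with $A_1\in\mathcal{B}[X]$, $A_2\in\mathcal{B}[Y]$, and $\mu\otimes\nu$ is the finitely additive product probability measure on it, with $(\mu\otimes\nu)(A_1\times A_2)=\mu(A_1)\nu(A_2)$. $\mathcal{B}[X]\otimes^{\sigma}\mathcal{B}[Y]$ denotes the $\sigma$-algebra generated by such rectangles. For a finitely additive probability space $(Z,\mathcal{F},\lambda)$, the completion $\mathcal{F}^{c}$ is the collection of all sets $A\subset Z$ such that for every $\epsilon>0$ there exist $A_1,A_2\in\mathcal{F}$ with $A_1\subset A\subset A_2$ and $\lambda(A_2\setminus A_1)<\epsilon$. Here $(\mathcal{B}[X]\otimes\mathcal{B}[Y])^{c}$ is the completion with respect to $\mu\otimes\nu$. *)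

theory Defs
  imports "HOL-Probability.Probability"
begin

definition atomless :: "'a measure \<Rightarrow> bool" where
  "atomless M \<longleftrightarrow>
    (\<forall>A\<in>sets M. emeasure M A > 0 \<longrightarrow>
      (\<exists>B\<in>sets M. B \<subseteq> A \<and> 0 < emeasure M B \<and> emeasure M B < emeasure M A))"

definition fa_prob_space :: "'z set \<Rightarrow> 'z set set \<Rightarrow> ('z set \<Rightarrow> real) \<Rightarrow> bool" where
  "fa_prob_space Z F l \<longleftrightarrow>
    algebra Z F \<and> (\<forall>A\<in>F. 0 \<le> l A) \<and> additive F l \<and> l Z = 1"

definition fa_completion :: "'z set \<Rightarrow> 'z set set \<Rightarrow> ('z set \<Rightarrow> real) \<Rightarrow> 'z set set" where
  "fa_completion Z F l =
    {A. A \<subseteq> Z \<and> (\<forall>e>0. \<exists>A1\<in>F. \<exists>A2\<in>F. A1 \<subseteq> A \<and> A \<subseteq> A2 \<and> l (A2 - A1) < e)}"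

definition rectangles :: "'a measure \<Rightarrow> 'b measure \<Rightarrow> ('a \<times> 'b) set set" where
  "rectangles M N = {A \<times> B | A B. A \<in> sets M \<and> B \<in> sets N}"

definition prod_algebra_fin :: "'a measure \<Rightarrow> 'b measure \<Rightarrow> ('a \<times> 'b) set set" where
  "prod_algebra_fin M N = algebra (space M \<times> space N) hull rectangles M N"

definition is_fa_product ::
    "'a measure \<Rightarrow> 'b measure \<Rightarrow> (('a \<times> 'b) set \<Rightarrow> real) \<Rightarrow> bool" where
  "is_fa_product M N l \<longleftrightarrow>
    fa_prob_space (space M \<times> space N) (prod_algebra_fin M N) l \<and>
    (\<forall>A\<in>sets M. \<forall>B\<in>sets N. l (A \<times> B) = measure M A * measure N B)"

(* Only the values on the algebra are determined; the requirement l \<in> extensional fixes the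
   irrelevant values elsewhere, so that the description is definite (ex1_fa_product below). *)
definition fa_product :: "'a measure \<Rightarrow> 'b measure \<Rightarrow> ('a \<times> 'b) set \<Rightarrow> real" where
  "fa_product M N = (THE l. l \<in> extensional (prod_algebra_fin M N) \<and> is_fa_product M N l)"

lemma semiring_rectangles: "semiring_of_sets (space M \<times> space N) (rectangles M N)"
proof
  show "rectangles M N \<subseteq> Pow (space M \<times> space N)"
    by (auto simp: rectangles_def dest: sets.sets_into_space)
  show "{} \<in> rectangles M N"
    by (auto simp: rectangles_def)
next
  fix a b assume "a \<in> rectangles M N" "b \<in> rectangles M N"
  then obtain A B C D where *: "a = A \<times> B" "b = C \<times> D"
    "A \<in> sets M" "B \<in> sets N" "C \<in> sets M" "D \<in> sets N"
    by (auto simp: rectangles_def)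
  have "a \<inter> b = (A \<inter> C) \<times> (B \<inter> D)" using * by auto
  then show "a \<inter> b \<in> rectangles M N"
    using * unfolding rectangles_def by blast
  let ?C = "{(A - C) \<times> B, (A \<inter> C) \<times> (B - D)}"
  have "?C \<subseteq> rectangles M N" using * unfolding rectangles_def by blast
  moreover have "finite ?C" "disjoint ?C" "a - b = \<Union>?C"
    using * by (auto simp: disjoint_def)
  ultimately show "\<exists>C\<subseteq>rectangles M N. finite C \<and> disjoint C \<and> a - b = \<Union>C"
    by blast
qed

lemma algebra_prod_algebra_fin: "algebra (space M \<times> space N) (prod_algebra_fin M N)"
  and rectangles_subset: "rectangles M N \<subseteq> prod_algebra_fin M N"
  and prod_algebra_fin_subset: "prod_algebra_fin M N \<subseteq> sets (M \<Otimes>\<^sub>M N)"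
  and prod_algebra_fin_eq:
    "prod_algebra_fin M N = semiring_of_sets.generated_ring (rectangles M N)"
proof -
  interpret R: semiring_of_sets "space M \<times> space N" "rectangles M N"
    by (rule semiring_rectangles)
  have rs: "rectangles M N \<subseteq> R.generated_ring"
    by (auto intro: R.generated_ringI_Basic)
  have "space M \<times> space N \<in> rectangles M N"
    unfolding rectangles_def by blast
  then have ga: "algebra (space M \<times> space N) R.generated_ring"
    using R.generating_ring rs by (auto simp: algebra_def algebra_axioms_def)
  show sub: "rectangles M N \<subseteq> prod_algebra_fin M N"
    unfolding prod_algebra_fin_def by (rule hull_subset)
  have sa: "algebra (space M \<times> space N) (sets (M \<Otimes>\<^sub>M N))"
    by (metis sets.sigma_algebra_axioms sigma_algebra.axioms(1) space_pair_measure)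
  have "rectangles M N \<subseteq> sets (M \<Otimes>\<^sub>M N)"
    by (auto simp: rectangles_def)
  then show "prod_algebra_fin M N \<subseteq> sets (M \<Otimes>\<^sub>M N)"
    unfolding prod_algebra_fin_def using sa by (intro hull_minimal)
  have *: "prod_algebra_fin M N \<subseteq> R.generated_ring"
    unfolding prod_algebra_fin_def using ga rs by (intro hull_minimal)
  show al: "algebra (space M \<times> space N) (prod_algebra_fin M N)"
  proof -
    let ?S = "{F. algebra (space M \<times> space N) F \<and> rectangles M N \<subseteq> F}"
    have alg: "F \<subseteq> Pow (space M \<times> space N)" "{} \<in> F"
        "\<And>a. a \<in> F \<Longrightarrow> space M \<times> space N - a \<in> F"
        "\<And>a b. a \<in> F \<Longrightarrow> b \<in> F \<Longrightarrow> a \<union> b \<in> F" if "F \<in> ?S" for F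
      using that by (simp_all add: algebra_iff_Un)
    have "R.generated_ring \<in> ?S" using ga rs by simp
    then have "\<Inter>?S \<subseteq> Pow (space M \<times> space N)"
      using alg(1) by (meson Inter_lower order_trans)
    moreover have "{} \<in> \<Inter>?S"
      by (rule InterI) (rule alg(2))
    moreover have "\<forall>a\<in>\<Inter>?S. space M \<times> space N - a \<in> \<Inter>?S"
      by (intro ballI InterI alg(3)) (assumption | erule InterD)+
    moreover have "\<forall>a\<in>\<Inter>?S. \<forall>b\<in>\<Inter>?S. a \<union> b \<in> \<Inter>?S"
      by (intro ballI InterI alg(4)) (assumption | erule InterD)+
    ultimately show ?thesis
      unfolding prod_algebra_fin_def hull_def algebra_iff_Un by (intro conjI)
  qed
  interpret P: algebra "space M \<times> space N" "prod_algebra_fin M N" by (rule al)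
  have "R.generated_ring \<subseteq> prod_algebra_fin M N"
    using sub by (auto elim!: R.generated_ringE)
  with * show "prod_algebra_fin M N = R.generated_ring" by blast
qed

lemma is_fa_product_pair_measure:
  assumes "prob_space M" "prob_space N"
  shows "is_fa_product M N (measure (M \<Otimes>\<^sub>M N))"
proof -
  interpret M: prob_space M by fact
  interpret N: prob_space N by fact
  interpret P: pair_prob_space M N ..
  have "additive (prod_algebra_fin M N) (measure (M \<Otimes>\<^sub>M N))"
    unfolding additive_def using prod_algebra_fin_subset[of M N]
    by (auto intro!: P.finite_measure_Union)
  moreover have "measure (M \<Otimes>\<^sub>M N) (space M \<times> space N) = 1"
    using P.prob_space by (simp add: space_pair_measure)
  moreover have "measure (M \<Otimes>\<^sub>M N) (A \<times> B) = measure M A * measure N B"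
    if "A \<in> sets M" "B \<in> sets N" for A B
    using that by (simp add: N.emeasure_pair_measure_Times measure_def enn2real_mult)
  ultimately show ?thesis
    by (auto simp: is_fa_product_def fa_prob_space_def algebra_prod_algebra_fin)
qed

lemma is_fa_product_unique:
  assumes l: "is_fa_product M N l" and k: "is_fa_product M N k"
    and "E \<in> prod_algebra_fin M N"
  shows "l E = k E"
proof -
  interpret R: semiring_of_sets "space M \<times> space N" "rectangles M N"
    by (rule semiring_rectangles)
  interpret P: algebra "space M \<times> space N" "prod_algebra_fin M N"
    by (rule algebra_prod_algebra_fin)
  have "E \<in> R.generated_ring" using assms(3) prod_algebra_fin_eq by blast
  then obtain C where C: "finite C" "disjoint C" "C \<subseteq> rectangles M N" "E = \<Union>C"
    by (rule R.generated_ringE) blast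
  have al: "additive (prod_algebra_fin M N) l" and ak: "additive (prod_algebra_fin M N) k"
    using l k by (auto simp: is_fa_product_def fa_prob_space_def)
  have rect: "l c = k c" if "c \<in> rectangles M N" for c
    using that l k by (auto simp: is_fa_product_def rectangles_def)
  have "l (\<Union>C) = k (\<Union>C)"
    using C(1,2,3)
  proof (induction C rule: finite_induct)
    case empty
    have "{} \<in> rectangles M N" by auto
    then show ?case using rect by simp
  next
    case (insert c C)
    have cC: "c \<in> prod_algebra_fin M N" "\<Union>C \<in> prod_algebra_fin M N"
      using insert rectangles_subset[of M N] by auto
    have d: "c \<inter> \<Union>C = {}"
      using insert by (auto simp: disjoint_def)
    have "disjoint C" using insert.prems by (auto simp: disjoint_def)
    then show ?case
      using additiveD[OF al d cC] additiveD[OF ak d cC] insert rect by simp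
  qed
  then show ?thesis using C by simp
qed

lemma ex1_fa_product:
  assumes "prob_space M" "prob_space N"
  shows "\<exists>!l. l \<in> extensional (prod_algebra_fin M N) \<and> is_fa_product M N l"
proof (rule ex_ex1I)
  interpret P: algebra "space M \<times> space N" "prod_algebra_fin M N"
    by (rule algebra_prod_algebra_fin)
  let ?l = "restrict (measure (M \<Otimes>\<^sub>M N)) (prod_algebra_fin M N)"
  have "A \<times> B \<in> prod_algebra_fin M N" if "A \<in> sets M" "B \<in> sets N" for A B
    using that rectangles_subset[of M N] unfolding rectangles_def by blast
  then have "is_fa_product M N ?l"
    using is_fa_product_pair_measure[OF assms]
    by (auto simp: is_fa_product_def fa_prob_space_def additive_def)
  then show "\<exists>l. l \<in> extensional (prod_algebra_fin M N) \<and> is_fa_product M N l"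
    by auto
next
  fix l k
  assume "l \<in> extensional (prod_algebra_fin M N) \<and> is_fa_product M N l"
    "k \<in> extensional (prod_algebra_fin M N) \<and> is_fa_product M N k"
  then show "l = k"
    by (auto intro: extensionalityI is_fa_product_unique)
qed

lemma is_fa_product_fa_product:
  "prob_space M \<Longrightarrow> prob_space N \<Longrightarrow> is_fa_product M N (fa_product M N)"
  unfolding fa_product_def using theI'[OF ex1_fa_product[of M N]] by blast

lemma fa_product_eq_pair_measure:
  assumes "prob_space M" "prob_space N" "E \<in> prod_algebra_fin M N"
  shows "fa_product M N E = measure (M \<Otimes>\<^sub>M N) E"
  using assms is_fa_product_unique is_fa_product_fa_product is_fa_product_pair_measure by blast

end

theory Submission
  imports Defs
begin

text \<open>
  It suffices to find a measurable set \<open>E\<close> of positive product measure that includes no rectangle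
  of positive measure.  Indeed, a member of the algebra inside \<open>E\<close> is a finite union of rectangles
  and therefore null, whereas every member that covers \<open>E\<close> has at least the measure of \<open>E\<close>; so the
  gap between inner and outer approximations never drops below the measure of \<open>E\<close>.

  To find \<open>E\<close>, equip each factor with an independent sequence of digits, the \<open>n\<close>-th of them uniform
  on \<open>{..<K n}\<close> with \<open>K n = 2 ^ (n + 2)\<close>, and let \<open>E\<close> be the set of all pairs \<open>(x, y)\<close> whose digits
  differ at every position.  The \<open>n\<close>-th digits agree with probability \<open>1 / K n\<close>, and these
  probabilities add up to \<open>1 / 2\<close>, so \<open>E\<close> has measure at least \<open>1 / 2\<close>.

  Let \<open>S \<times> T\<close> be a rectangle inside \<open>E\<close>.  The \<open>n\<close>-th digits that occur in \<open>S\<close> form a set \<open>I n\<close>, and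
  those that occur in \<open>T\<close> avoid \<open>I n\<close>.  If \<open>p n\<close> is the proportion of \<open>I n\<close> in \<open>{..<K n}\<close>, then by
  independence \<open>S\<close> has measure at most the product of the first \<open>N\<close> numbers \<open>p n\<close>, and \<open>T\<close> at most
  that of the numbers \<open>1 - p n\<close>.  Since \<open>p * (1 - p) \<le> 1 / 4\<close>, the rectangle has measure at most
  \<open>(1 / 4) ^ N\<close> for every \<open>N\<close>.

  The digits exist because an atomless measure takes all intermediate values (Sierpinski's theorem):
  each of the finitely many cells that are determined by the earlier digits can be divided into
  \<open>K n\<close> parts of equal measure.
\<close>

section \<open>Intermediate values of atomless measures\<close>

text \<open>Divide \<open>A\<close> into two parts of positive measure: one of them has at most half the measure of
  \<open>A\<close>.  Repeat with that part.\<close>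

lemma atomless_small_subset:
  assumes "finite_measure M" "atomless M" "A \<in> sets M" "measure M A > 0" "e > 0"
  shows "\<exists>B\<in>sets M. B \<subseteq> A \<and> 0 < measure M B \<and> measure M B < e"
proof -
  interpret finite_measure M by fact
  have half: "\<exists>B\<in>sets M. B \<subseteq> C \<and> 0 < measure M B \<and> measure M B \<le> measure M C / 2"
    if C: "C \<in> sets M" "measure M C > 0" for C
  proof -
    have "emeasure M C > 0" using C by (simp add: emeasure_eq_measure)
    then obtain B where B: "B \<in> sets M" "B \<subseteq> C" "0 < measure M B" "measure M B < measure M C"
      using assms(2) C unfolding atomless_def
      by (auto simp: emeasure_eq_measure ennreal_less_iff)
    have "measure M (C - B) = measure M C - measure M B"
      using B C by (simp add: finite_measure_Diff)
    moreover have "C - B \<in> sets M" using B C by auto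
    ultimately have "0 < measure M (C - B)" "measure M B \<le> measure M C / 2 \<or> measure M (C - B) \<le> measure M C / 2"
      using B by linarith+
    with \<open>C - B \<in> sets M\<close> B show ?thesis by blast
  qed
  have pow: "\<exists>B\<in>sets M. B \<subseteq> A \<and> 0 < measure M B \<and> measure M B \<le> measure M A / 2 ^ n" for n
  proof (induction n)
    case 0
    then show ?case using assms by auto
  next
    case (Suc n)
    then obtain B where B: "B \<in> sets M" "B \<subseteq> A" "0 < measure M B" "measure M B \<le> measure M A / 2 ^ n"
      by auto
    obtain C where "C \<in> sets M" "C \<subseteq> B" "0 < measure M C" "measure M C \<le> measure M B / 2"
      using half[OF B(1,3)] by auto
    moreover have "measure M B / 2 \<le> measure M A / 2 ^ Suc n"
      using B(4) by (simp add: field_simps)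
    ultimately show ?case using B(2) by (intro bexI[of _ C] conjI) (blast | linarith)+
  qed
  obtain n where "measure M A / e < 2 ^ n"
    using real_arch_pow[of 2 "measure M A / e"] by auto
  then have "measure M A / 2 ^ n < e"
    using assms(5) by (simp add: field_simps)
  with pow[of n] show ?thesis by (meson le_less_trans)
qed

text \<open>A greedy exhaustion: at each step, enlarge the current set at least half as much as is
  possible without exceeding \<open>t\<close>.  If the union of these sets had measure less than \<open>t\<close>, a small
  set could still be added to it, and each greedy step would have gained at least half the measure
  of that set, although the gains tend to \<open>0\<close>.\<close>

lemma atomless_intermediate_value:
  assumes "finite_measure M" "atomless M" "A \<in> sets M" "0 \<le> t" "t \<le> measure M A"
  shows "\<exists>B\<in>sets M. B \<subseteq> A \<and> measure M B = t"
proof -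
  interpret finite_measure M by fact
  define ok where "ok B \<longleftrightarrow> B \<in> sets M \<and> B \<subseteq> A \<and> measure M B \<le> t" for B
  have ex: "\<exists>C. ok C \<and> B \<subseteq> C \<and>
      (\<forall>D. ok D \<and> B \<subseteq> D \<longrightarrow> measure M D \<le> 2 * measure M C - measure M B)" if B: "ok B" for B
  proof (rule ccontr)
    assume neg: "\<not> ?thesis"
    define V where "V = measure M ` {D. ok D \<and> B \<subseteq> D}"
    have V: "V \<noteq> {}" "bdd_above V"
      using B by (auto simp: V_def ok_def intro!: bdd_aboveI[of _ t])
    have le: "measure M D \<le> Sup V" if "ok D" "B \<subseteq> D" for D
      using that V by (auto simp: V_def intro!: cSup_upper)
    have "measure M B < Sup V"
    proof -
      obtain D where "ok D" "B \<subseteq> D" "measure M B < measure M D"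
        using neg B by force
      then show ?thesis using le[of D] by linarith
    qed
    then have "(measure M B + Sup V) / 2 < Sup V" by simp
    then obtain C where C: "ok C" "B \<subseteq> C" "(measure M B + Sup V) / 2 < measure M C"
      using less_cSup_iff[OF V] unfolding V_def by auto
    have "measure M D \<le> 2 * measure M C - measure M B" if "ok D" "B \<subseteq> D" for D
      using le[OF that] C(3) by (simp add: field_simps)
    with C neg show False by blast
  qed
  have "\<exists>B. \<forall>n. ok (B n) \<and> (B n \<subseteq> B (Suc n) \<and>
      (\<forall>D. ok D \<and> B n \<subseteq> D \<longrightarrow> measure M D \<le> 2 * measure M (B (Suc n)) - measure M (B n)))"
    using ex assms(4) by (intro dependent_nat_choice) (auto simp: ok_def intro!: exI[of _ "{}"])
  then obtain B where B: "\<And>n. ok (B n)" "\<And>n. B n \<subseteq> B (Suc n)"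
    "\<And>n D. ok D \<Longrightarrow> B n \<subseteq> D \<Longrightarrow> measure M D \<le> 2 * measure M (B (Suc n)) - measure M (B n)"
    by blast
  define U where "U = (\<Union>n. B n)"
  have inc: "incseq B" using B(2) by (rule incseq_SucI)
  have U: "U \<in> sets M" "U \<subseteq> A" using B(1) by (auto simp: U_def ok_def)
  have lim: "(\<lambda>n. measure M (B n)) \<longlonglongrightarrow> measure M U"
    unfolding U_def using B(1) inc by (intro finite_Lim_measure_incseq) (auto simp: ok_def)
  have le: "measure M U \<le> t"
    using B(1) by (intro LIMSEQ_le_const2[OF lim]) (auto simp: ok_def)
  have "measure M U = t"
  proof (rule ccontr)
    assume "measure M U \<noteq> t"
    with le have lt: "measure M U < t" by simp
    have "measure M (A - U) = measure M A - measure M U"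
      using U assms(3) by (simp add: finite_measure_Diff)
    then have "0 < measure M (A - U)" "A - U \<in> sets M" using lt assms U by auto
    from atomless_small_subset[OF assms(1,2) this(2,1), of "t - measure M U"] lt
    obtain D where D: "D \<in> sets M" "D \<subseteq> A - U" "0 < measure M D" "measure M D < t - measure M U"
      by auto
    have m: "measure M (U \<union> D) = measure M U + measure M D"
      using D U by (intro finite_measure_Union) auto
    have "ok (U \<union> D)" using D U m by (auto simp: ok_def)
    moreover have "B n \<subseteq> U \<union> D" for n by (auto simp: U_def)
    ultimately have "measure M (U \<union> D) \<le> 2 * measure M (B (Suc n)) - measure M (B n)" for n
      using B(3) by blast
    moreover have "(\<lambda>n. 2 * measure M (B (Suc n)) - measure M (B n)) \<longlonglongrightarrow> 2 * measure M U - measure M U"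
      using lim by (intro tendsto_intros LIMSEQ_Suc)
    ultimately have "measure M (U \<union> D) \<le> 2 * measure M U - measure M U"
      by (intro LIMSEQ_le_const) auto
    with m D show False by simp
  qed
  with U show ?thesis by blast
qed

text \<open>Cut off the share of one digit and divide the rest equally by induction.\<close>

lemma atomless_equal_division:
  assumes "finite_measure M" "atomless M" "A \<in> sets M" "0 < (m::nat)"
  shows "\<exists>g. g \<in> measurable M (count_space UNIV) \<and> (\<forall>x. g x < m) \<and>
    (\<forall>k<m. measure M {x\<in>A. g x = k} = measure M A / m)"
  using assms(4,3)
proof (induction m arbitrary: A rule: nat_induct_non_zero)
  case 1
  then show ?case by (intro exI[of _ "\<lambda>_. 0"]) auto
next
  case (Suc m)
  interpret finite_measure M by fact
  have "measure M A / Suc m \<le> measure M A" by (simp add: field_simps)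
  with atomless_intermediate_value[OF assms(1,2) Suc.prems, of "measure M A / Suc m"]
  obtain B where B: "B \<in> sets M" "B \<subseteq> A" "measure M B = measure M A / Suc m"
    by auto
  have AB: "A - B \<in> sets M" using B Suc.prems by auto
  have "measure M (A - B) = measure M A - measure M B"
    using B Suc.prems by (simp add: finite_measure_Diff)
  then have eq: "measure M (A - B) / m = measure M A / Suc m"
    using B Suc.hyps by (simp add: field_simps)
  obtain g where g: "g \<in> measurable M (count_space UNIV)" "\<And>x. g x < m"
      "\<And>k. k < m \<Longrightarrow> measure M {x\<in>A - B. g x = k} = measure M (A - B) / m"
    using Suc.IH[OF AB] by blast
  let ?h = "\<lambda>x. if x \<in> B then m else g x"
  have "{x\<in>A. ?h x = k} = (if k = m then B else {x\<in>A - B. g x = k})" if "k < Suc m" for k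
    using B g(2) by (auto simp: less_imp_neq)
  then have "measure M {x\<in>A. ?h x = k} = measure M A / Suc m" if "k < Suc m" for k
    using that B g(3) eq by auto
  moreover have "?h \<in> measurable M (count_space UNIV)"
    using g(1) B by measurable
  ultimately show ?case
    using g(2) by (intro exI[of _ ?h]) (auto simp: less_Suc_eq)
qed

section \<open>Independent uniform digits\<close>

text \<open>\<open>history G X n x\<close> lists the first \<open>n\<close> digits of \<open>x\<close>, the latest one first.  The points of \<open>X\<close>
  with the same history as \<open>x\<close> form a cell \<open>A\<close>, and \<open>G n A\<close> is the function that assigns the next
  digit within this cell.\<close>

primrec history :: "(nat \<Rightarrow> 'a set \<Rightarrow> 'a \<Rightarrow> nat) \<Rightarrow> 'a set \<Rightarrow> nat \<Rightarrow> 'a \<Rightarrow> nat list" where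
  "history G X 0 = (\<lambda>x. [])"
| "history G X (Suc n) =
    (\<lambda>x. G n {y\<in>X. history G X n y = history G X n x} x # history G X n x)"

text \<open>The next digit is uniform on each cell of the current history, hence independent of the
  history; by induction, all the digits are independent.\<close>

lemma atomless_independent_uniform_digits:
  fixes K :: "nat \<Rightarrow> nat"
  assumes "prob_space M" "atomless M" and K: "\<And>n. 0 < K n"
  obtains d where "\<And>n. d n \<in> measurable M (count_space UNIV)" "\<And>n x. d n x < K n"
    "\<And>I N. (\<And>n. I n \<subseteq> {..<K n}) \<Longrightarrow>
      measure M {x\<in>space M. \<forall>n<N. d n x \<in> I n} = (\<Prod>n<N. card (I n) / K n)"
proof -
  interpret prob_space M by fact
  define equal_division where "equal_division n A g \<longleftrightarrow>
      g \<in> measurable M (count_space UNIV) \<and> (\<forall>x. g x < K n) \<and>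
      (\<forall>k<K n. measure M {x\<in>A. g x = k} = measure M A / K n)" for n A g
  define G where "G n A = (SOME g. equal_division n A g)" for n A
  have "equal_division n A (G n A)" if "A \<in> sets M" for n A
  proof -
    have "\<exists>g. equal_division n A g"
      unfolding equal_division_def
      by (rule atomless_equal_division[OF finite_measure_axioms assms(2) that K])
    then show ?thesis unfolding G_def by (rule someI_ex)
  qed
  then have G: "\<And>n A. A \<in> sets M \<Longrightarrow> G n A \<in> measurable M (count_space UNIV)"
      "\<And>n A x. A \<in> sets M \<Longrightarrow> G n A x < K n"
      "\<And>n A k. A \<in> sets M \<Longrightarrow> k < K n \<Longrightarrow> measure M {x\<in>A. G n A x = k} = measure M A / K n"
    unfolding equal_division_def by auto
  define c where "c = history G (space M)"
  define cell where "cell n w = {y\<in>space M. c n y = w}" for n w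
  define d where "d n x = G n (cell n (c n x)) x" for n x
  have c0: "c 0 x = []" and cS: "c (Suc n) x = d n x # c n x" for n x
    by (simp_all add: c_def d_def cell_def)
  have cellI: "cell n w \<in> sets M" if "c n \<in> measurable M (count_space UNIV)" for n w
    using that unfolding cell_def by measurable
  have dI: "d n \<in> measurable M (count_space UNIV)" if "c n \<in> measurable M (count_space UNIV)" for n
    unfolding d_def
    by (rule measurable_compose_countable[OF _ that]) (use G(1) cellI[OF that] in auto)
  have cm: "c n \<in> measurable M (count_space UNIV)" for n
  proof (induction n)
    case 0
    have "c 0 = (\<lambda>x. [])" using c0 by auto
    then show ?case by simp
  next
    case (Suc n)
    note [measurable] = Suc dI[OF Suc]
    have "c (Suc n) = (\<lambda>x. d n x # c n x)" using cS by auto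
    then show ?case by simp
  qed
  note dm = dI[OF cm] and cell = cellI[OF cm]
  have dK: "d n x < K n" for n x
    using G(2)[OF cell] by (simp add: d_def)
  have fin: "finite (range (c n))" for n
  proof (induction n)
    case 0
    have "range (c 0) \<subseteq> {[]}" using c0 by auto
    then show ?case by (rule finite_subset) simp
  next
    case (Suc n)
    have "range (c (Suc n)) \<subseteq> (\<lambda>(k, w). k # w) ` ({..<K n} \<times> range (c n))"
      using cS dK by (auto simp: image_iff)
    then show ?case by (rule finite_subset) (use Suc in auto)
  qed
  have step: "measure M {x\<in>space M. c n x \<in> J \<and> d n x \<in> I} =
      measure M {x\<in>space M. c n x \<in> J} * (card I / K n)" if I: "I \<subseteq> {..<K n}" for n J I
  proof -
    have finI: "finite I" using I finite_subset by blast
    let ?R = "J \<inter> range (c n)"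
    have "{x\<in>space M. c n x \<in> J} = (\<Union>w\<in>?R. cell n w)"
      by (auto simp: cell_def)
    then have 1: "measure M {x\<in>space M. c n x \<in> J} = (\<Sum>w\<in>?R. measure M (cell n w))"
      using fin cell by (simp, intro finite_measure_finite_Union) (auto simp: cell_def disjoint_family_on_def)
    let ?S = "\<lambda>(w, k). {x\<in>cell n w. G n (cell n w) x = k}"
    have "{x\<in>space M. c n x \<in> J \<and> d n x \<in> I} = (\<Union>p\<in>?R \<times> I. ?S p)"
      by (auto simp: cell_def d_def)
    moreover have "?S p \<in> sets M" for p
    proof -
      note [measurable] = cell[of n "fst p"] G(1)[OF cell[of n "fst p"], of n]
      show ?thesis unfolding split_beta by measurable
    qed
    ultimately have "measure M {x\<in>space M. c n x \<in> J \<and> d n x \<in> I} = (\<Sum>p\<in>?R \<times> I. measure M (?S p))"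
      using fin finI
      by (simp only:, intro finite_measure_finite_Union) (auto simp: cell_def disjoint_family_on_def)
    also have "\<dots> = (\<Sum>(w, k)\<in>?R \<times> I. measure M (cell n w) / K n)"
      using I G(3)[OF cell] by (intro sum.cong) auto
    also have "\<dots> = (\<Sum>w\<in>?R. \<Sum>k\<in>I. measure M (cell n w) / K n)"
      by (simp only: sum.cartesian_product)
    also have "\<dots> = (\<Sum>w\<in>?R. measure M (cell n w) * (card I / K n))"
      by (simp add: mult.commute)
    finally show ?thesis
      unfolding 1 by (simp only: sum_distrib_right)
  qed
  have "measure M {x\<in>space M. \<forall>n<N. d n x \<in> I n} = (\<Prod>n<N. card (I n) / K n)"
    if I: "\<And>n. I n \<subseteq> {..<K n}" for I N
  proof (induction N)
    case 0
    then show ?case using prob_space by simp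
  next
    case (Suc N)
    have "\<exists>J. \<forall>x. (\<forall>n<m. d n x \<in> I n) \<longleftrightarrow> c m x \<in> J" for m
    proof (induction m)
      case 0
      then show ?case by auto
    next
      case (Suc m)
      then obtain J where "\<forall>x. (\<forall>n<m. d n x \<in> I n) \<longleftrightarrow> c m x \<in> J" by blast
      then show ?case
        by (intro exI[of _ "{k # w | k w. k \<in> I m \<and> w \<in> J}"]) (auto simp: cS less_Suc_eq)
    qed
    then obtain J where J: "\<And>x. (\<forall>n<N. d n x \<in> I n) \<longleftrightarrow> c N x \<in> J" by blast
    have "(\<forall>n<Suc N. d n x \<in> I n) \<longleftrightarrow> c N x \<in> J \<and> d N x \<in> I N" for x
      using J[of x] by (auto simp: less_Suc_eq)
    then show ?case using step[OF I, of N J] Suc J by simp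
  qed
  then show ?thesis using that[of d] dm dK by blast
qed

section \<open>A large set without large rectangles\<close>

lemma same_values_eq_Union_rectangles:
  fixes f :: "'a \<Rightarrow> nat" and g :: "'b \<Rightarrow> nat"
  assumes "\<And>x. f x < K"
  shows "{p\<in>space (M \<Otimes>\<^sub>M N). f (fst p) = g (snd p)} =
    (\<Union>k<K. {x\<in>space M. f x = k} \<times> {y\<in>space N. g y = k})"
proof -
  have "g y < K" if "f x = g y" for x y
    using assms[of x] that by simp
  then show ?thesis by (auto simp: space_pair_measure)
qed

lemma sets_same_values:
  fixes f :: "'a \<Rightarrow> nat" and g :: "'b \<Rightarrow> nat"
  assumes [measurable]: "f \<in> measurable M (count_space UNIV)" "g \<in> measurable N (count_space UNIV)"
    and f: "\<And>x. f x < K"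
  shows "{p\<in>space (M \<Otimes>\<^sub>M N). f (fst p) = g (snd p)} \<in> sets (M \<Otimes>\<^sub>M N)"
  unfolding same_values_eq_Union_rectangles[where f = f, OF f] by auto

lemma prob_same_uniform_values:
  fixes f :: "'a \<Rightarrow> nat" and g :: "'b \<Rightarrow> nat"
  assumes "prob_space M" "prob_space N"
    and [measurable]: "f \<in> measurable M (count_space UNIV)" "g \<in> measurable N (count_space UNIV)"
    and f: "\<And>x. f x < K" and unif: "\<And>k. k < K \<Longrightarrow> measure M {x\<in>space M. f x = k} = 1 / K"
      "\<And>k. k < K \<Longrightarrow> measure N {y\<in>space N. g y = k} = 1 / K"
  shows "measure (M \<Otimes>\<^sub>M N) {p\<in>space (M \<Otimes>\<^sub>M N). f (fst p) = g (snd p)} \<le> 1 / K"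
proof -
  interpret M: prob_space M by fact
  interpret N: prob_space N by fact
  interpret P: pair_prob_space M N ..
  let ?A = "\<lambda>k. {x\<in>space M. f x = k}" and ?B = "\<lambda>k. {y\<in>space N. g y = k}"
  have "measure (M \<Otimes>\<^sub>M N) {p\<in>space (M \<Otimes>\<^sub>M N). f (fst p) = g (snd p)} \<le>
      (\<Sum>k<K. measure (M \<Otimes>\<^sub>M N) (?A k \<times> ?B k))"
    unfolding same_values_eq_Union_rectangles[where f = f, OF f]
    by (intro P.finite_measure_subadditive_finite) auto
  also have "\<dots> = (\<Sum>k<K. 1 / K * (1 / K))"
    using unif by (intro sum.cong) (auto simp: N.emeasure_pair_measure_Times measure_def enn2real_mult)
  also have "\<dots> \<le> 1 / K" by simp
  finally show ?thesis .
qed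

lemma exists_positive_set_with_null_rectangles:
  assumes "prob_space M" "atomless M" "prob_space N" "atomless N"
  shows "\<exists>E\<in>sets (M \<Otimes>\<^sub>M N). 0 < measure (M \<Otimes>\<^sub>M N) E \<and>
    (\<forall>S\<in>sets M. \<forall>T\<in>sets N. S \<times> T \<subseteq> E \<longrightarrow> measure M S * measure N T = 0)"
proof -
  interpret M: prob_space M by fact
  interpret N: prob_space N by fact
  interpret P: pair_prob_space M N ..
  define K :: "nat \<Rightarrow> nat" where "K n = 2 ^ (n + 2)" for n
  have K: "0 < K n" for n by (simp add: K_def)
  obtain d where d: "\<And>n. d n \<in> measurable M (count_space UNIV)" "\<And>n x. d n x < K n"
    "\<And>I m. (\<And>n. I n \<subseteq> {..<K n}) \<Longrightarrow>
      measure M {x\<in>space M. \<forall>n<m. d n x \<in> I n} = (\<Prod>n<m. card (I n) / K n)"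
    using atomless_independent_uniform_digits[OF assms(1,2), of K] K by blast
  obtain b where b: "\<And>n. b n \<in> measurable N (count_space UNIV)" "\<And>n x. b n x < K n"
    "\<And>I m. (\<And>n. I n \<subseteq> {..<K n}) \<Longrightarrow>
      measure N {x\<in>space N. \<forall>n<m. b n x \<in> I n} = (\<Prod>n<m. card (I n) / K n)"
    using atomless_independent_uniform_digits[OF assms(3,4), of K] K by blast
  note [measurable] = d(1) b(1)
  have b_sets: "{y\<in>space N. \<forall>n<m. b n y \<in> J n} \<in> sets N" for J and m :: nat
    by measurable
  define F where "F n = {p\<in>space (M \<Otimes>\<^sub>M N). d n (fst p) = b n (snd p)}" for n
  have Fm: "F n \<in> sets (M \<Otimes>\<^sub>M N)" for n
    unfolding F_def using d(1,2) b(1) by (intro sets_same_values)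
  define E where "E = space (M \<Otimes>\<^sub>M N) - (\<Union>n. F n)"
  have Em: "E \<in> sets (M \<Otimes>\<^sub>M N)" using Fm by (auto simp: E_def)
  have F: "measure (M \<Otimes>\<^sub>M N) (F n) \<le> (1/2) ^ n / 4" for n
  proof -
    \<comment> \<open>The distribution of a single digit is the case where the other digits are unconstrained.\<close>
    let ?I = "\<lambda>k i. if i = n then {k} else {..<K i}"
    have one: "(\<Prod>i<Suc n. card (?I k i) / K i) = 1 / K n" for k
      by (simp add: K_def)
    have "{x\<in>space M. d n x = k} = {x\<in>space M. \<forall>i<Suc n. d i x \<in> ?I k i}"
      "{x\<in>space N. b n x = k} = {x\<in>space N. \<forall>i<Suc n. b i x \<in> ?I k i}" for k
      using d(2) b(2) by auto
    then have "measure (M \<Otimes>\<^sub>M N) (F n) \<le> 1 / K n"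
      unfolding F_def using d b one
      by (intro prob_same_uniform_values assms) (simp_all del: prod.lessThan_Suc)
    then show ?thesis by (simp add: K_def power_one_over)
  qed
  have sums: "(\<lambda>n. (1/2::real) ^ n / 4) sums (1/2)"
    using sums_divide[OF geometric_sums[of "1/2::real"], of 4] by simp
  have smF: "summable (\<lambda>n. measure (M \<Otimes>\<^sub>M N) (F n))"
    by (rule summable_comparison_test'[OF sums_summable[OF sums], of 0]) (use F in auto)
  have "measure (M \<Otimes>\<^sub>M N) (\<Union>n. F n) \<le> (\<Sum>n. measure (M \<Otimes>\<^sub>M N) (F n))"
    using Fm smF by (intro P.finite_measure_subadditive_countably) auto
  also have "\<dots> \<le> 1/2"
    using suminf_le[OF F smF sums_summable[OF sums]] sums_unique[OF sums] by simp
  finally have pos: "0 < measure (M \<Otimes>\<^sub>M N) E"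
    using Fm by (simp add: E_def P.prob_compl)
  have "measure M S * measure N T = 0" if S: "S \<in> sets M" and T: "T \<in> sets N" and ST: "S \<times> T \<subseteq> E" for S T
  proof -
    define I where "I n = d n ` S" for n
    have I: "I n \<subseteq> {..<K n}" for n using d(2) by (auto simp: I_def)
    have disj: "b n y \<notin> I n" if "y \<in> T" for n y
    proof
      assume "b n y \<in> I n"
      then obtain x where "x \<in> S" "d n x = b n y" by (auto simp: I_def)
      with that ST show False by (auto simp: E_def F_def)
    qed
    define p :: "nat \<Rightarrow> real" where "p n = card (I n) / K n" for n
    have q: "card ({..<K n} - I n) / K n = 1 - p n" for n
      using I[of n] K[of n] card_mono[OF _ I[of n]]
      by (simp add: p_def card_Diff_subset finite_subset of_nat_diff field_simps)
    have bound: "measure M S * measure N T \<le> (1/4) ^ m" for m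
    proof -
      have "S \<subseteq> {x\<in>space M. \<forall>n<m. d n x \<in> I n}"
        using sets.sets_into_space[OF S] by (auto simp: I_def)
      moreover have "{x\<in>space M. \<forall>n<m. d n x \<in> I n} \<in> sets M" by measurable
      ultimately have "measure M S \<le> measure M {x\<in>space M. \<forall>n<m. d n x \<in> I n}"
        by (rule M.finite_measure_mono)
      also have "\<dots> = (\<Prod>n<m. p n)"
        using d(3)[OF I, of m] by (simp add: p_def)
      finally have S_le: "measure M S \<le> (\<Prod>n<m. p n)" .
      have "T \<subseteq> {y\<in>space N. \<forall>n<m. b n y \<in> {..<K n} - I n}"
        using sets.sets_into_space[OF T] disj b(2) by auto
      moreover have "{y\<in>space N. \<forall>n<m. b n y \<in> {..<K n} - I n} \<in> sets N"
        by (rule b_sets)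
      ultimately have "measure N T \<le> measure N {y\<in>space N. \<forall>n<m. b n y \<in> {..<K n} - I n}"
        by (rule N.finite_measure_mono)
      also have "\<dots> = (\<Prod>n<m. card ({..<K n} - I n) / K n)"
        by (rule b(3)) blast
      also have "\<dots> = (\<Prod>n<m. 1 - p n)"
        by (simp only: q)
      finally have "measure N T \<le> (\<Prod>n<m. 1 - p n)" .
      with S_le have "measure M S * measure N T \<le> (\<Prod>n<m. p n) * (\<Prod>n<m. 1 - p n)"
        by (intro mult_mono) (auto simp: p_def intro!: prod_nonneg)
      also have "\<dots> = (\<Prod>n<m. p n * (1 - p n))" by (simp add: prod.distrib)
      also have "\<dots> \<le> (\<Prod>n<m. 1/4)"
      proof (intro prod_mono conjI)
        fix n
        have "0 \<le> p n" "0 \<le> 1 - p n" unfolding q[symmetric] by (simp_all add: p_def)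
        then show "0 \<le> p n * (1 - p n)" by simp
        show "p n * (1 - p n) \<le> 1/4"
          using zero_le_power2[of "p n - 1/2"] by (simp add: power2_eq_square algebra_simps)
      qed
      finally show ?thesis by simp
    qed
    have "(\<lambda>m. (1/4::real) ^ m) \<longlonglongrightarrow> 0" by (rule LIMSEQ_realpow_zero) auto
    then have "measure M S * measure N T \<le> 0"
      using bound by (intro LIMSEQ_le_const) auto
    moreover have "0 \<le> measure M S * measure N T" by simp
    ultimately show ?thesis by (rule antisym)
  qed
  with Em pos show ?thesis by blast
qed

section \<open>Failure of finite approximation\<close>

text \<open>The algebra consists of the finite unions of rectangles, and every rectangle in such a union is
  a null set by assumption.\<close>

lemma prod_algebra_fin_null:
  assumes "prob_space M" "prob_space N" "A \<in> prod_algebra_fin M N"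
    and null: "\<And>S T. S \<in> sets M \<Longrightarrow> T \<in> sets N \<Longrightarrow> S \<times> T \<subseteq> A \<Longrightarrow> measure M S * measure N T = 0"
  shows "measure (M \<Otimes>\<^sub>M N) A = 0"
proof -
  interpret M: prob_space M by fact
  interpret N: prob_space N by fact
  interpret P: pair_prob_space M N ..
  interpret R: semiring_of_sets "space M \<times> space N" "rectangles M N"
    by (rule semiring_rectangles)
  have "A \<in> R.generated_ring" using assms(3) prod_algebra_fin_eq by blast
  then obtain C where C: "finite C" "C \<subseteq> rectangles M N" "A = \<Union>C"
    by (rule R.generated_ringE) blast
  have "c \<in> null_sets (M \<Otimes>\<^sub>M N)" if c: "c \<in> C" for c
  proof -
    obtain S T where ST: "c = S \<times> T" "S \<in> sets M" "T \<in> sets N"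
      using C c by (auto simp: rectangles_def)
    then have "measure M S * measure N T = 0" using null[of S T] C c by auto
    then show ?thesis
      using ST by (auto simp: null_sets_def N.emeasure_pair_measure_Times
          M.emeasure_eq_measure N.emeasure_eq_measure)
  qed
  then have "\<Union>C \<in> null_sets (M \<Otimes>\<^sub>M N)"
    using C(1) by (intro null_sets.finite_Union) auto
  then show ?thesis using C(3) by (simp add: measure_eq_0_null_sets)
qed

theorem theorem3p9:
  fixes \<mu> :: "'a::polish_space measure" and \<nu> :: "'b::polish_space measure"
  assumes "prob_space \<mu>" and "sets \<mu> = sets borel" and "atomless \<mu>"
    and "prob_space \<nu>" and "sets \<nu> = sets borel" and "atomless \<nu>"
  shows "\<exists>E \<in> sets (\<mu> \<Otimes>\<^sub>M \<nu>).
    E \<notin> fa_completion (space \<mu> \<times> space \<nu>) (prod_algebra_fin \<mu> \<nu>) (fa_product \<mu> \<nu>)"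
proof -
  interpret M: prob_space \<mu> by fact
  interpret N: prob_space \<nu> by fact
  interpret P: pair_prob_space \<mu> \<nu> ..
  interpret A: algebra "space \<mu> \<times> space \<nu>" "prod_algebra_fin \<mu> \<nu>"
    by (rule algebra_prod_algebra_fin)
  obtain E where E: "E \<in> sets (\<mu> \<Otimes>\<^sub>M \<nu>)" "0 < measure (\<mu> \<Otimes>\<^sub>M \<nu>) E"
    and null: "\<And>S T. S \<in> sets \<mu> \<Longrightarrow> T \<in> sets \<nu> \<Longrightarrow> S \<times> T \<subseteq> E \<Longrightarrow> measure \<mu> S * measure \<nu> T = 0"
    using exists_positive_set_with_null_rectangles[OF assms(1,3,4,6)] by blast
  have "E \<notin> fa_completion (space \<mu> \<times> space \<nu>) (prod_algebra_fin \<mu> \<nu>) (fa_product \<mu> \<nu>)"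
  proof
    assume "E \<in> fa_completion (space \<mu> \<times> space \<nu>) (prod_algebra_fin \<mu> \<nu>) (fa_product \<mu> \<nu>)"
    then obtain A1 A2 where A: "A1 \<in> prod_algebra_fin \<mu> \<nu>" "A2 \<in> prod_algebra_fin \<mu> \<nu>"
      "A1 \<subseteq> E" "E \<subseteq> A2" and lt: "fa_product \<mu> \<nu> (A2 - A1) < measure (\<mu> \<Otimes>\<^sub>M \<nu>) E"
      using E(2) unfolding fa_completion_def by blast
    have m: "A1 \<in> sets (\<mu> \<Otimes>\<^sub>M \<nu>)" "A2 \<in> sets (\<mu> \<Otimes>\<^sub>M \<nu>)"
      using A(1,2) prod_algebra_fin_subset by blast+
    have "measure (\<mu> \<Otimes>\<^sub>M \<nu>) A1 = 0"
      using null A(3) by (intro prod_algebra_fin_null[OF assms(1,4) A(1)]) blast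
    then have "measure (\<mu> \<Otimes>\<^sub>M \<nu>) E \<le> measure (\<mu> \<Otimes>\<^sub>M \<nu>) (A2 - A1)"
      using m A(3,4) P.finite_measure_mono[OF A(4) m(2)] by (simp add: P.finite_measure_Diff)
    also have "\<dots> = fa_product \<mu> \<nu> (A2 - A1)"
      using A by (intro fa_product_eq_pair_measure[symmetric] assms) auto
    finally show False using lt by simp
  qed
  with E(1) show ?thesis by blast
qed

end
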